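(* Let $k\geq 1$ and $t$ be integers, and let $G$ be a $t$-connected graph with $n$ vertices, where $n\geq k+1$. If $t\geq k$ and $n\geq \tfrac{1}{2}kt$, then the $k$-token graph $F_k(G)$ is $k(t-k+1)$-connected.
   Context: Graphs are finite, simple and undirected. For a graph $G$ and an integer $k\geq 1$, the $k$-token graph $F_k(G)$ is the graph whose vertices are the $k$-element subsets of $V(G)$, where two vertices $A,B$ are adjacent whenever their symmetric difference $A\triangle B$ is a pair $\{a,b\}$ with $a\in A$, $b\in B$ and $ab\in E(G)$. A graph $G$ is $t$-connected if $|V(G)|>t$ and $G-X$ is connected for every $X\subseteq V(G)$ with $|X|<t$. *)

theory Defs
  imports Complex_Main "Graph_Theory.Graph_Theory"
begin

text \<open>
  A finite simple undirected graph is a \<^locale>\<open>pair_graph\<close>: a finite vertex set together with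
  a symmetric, irreflexive set of ordered pairs of vertices, each undirected edge being
  represented by its two orientations.
\<close>

definition t_connected :: "nat \<Rightarrow> 'a pair_pre_digraph \<Rightarrow> bool" where
  "t_connected t G \<longleftrightarrow>
     card (pverts G) > t \<and>
     (\<forall>X. X \<subseteq> pverts G \<and> card X < t \<longrightarrow> connected (with_proj G \<restriction> (pverts G - X)))"

definition token_graph :: "nat \<Rightarrow> 'a pair_pre_digraph \<Rightarrow> 'a set pair_pre_digraph" where
  "token_graph k G =
     (let V = {A. A \<subseteq> pverts G \<and> finite A \<and> card A = k}
      in \<lparr> pverts = V,
           parcs = {(A, B). A \<in> V \<and> B \<in> V \<and>
             (\<exists>a\<in>A. \<exists>b\<in>B. (A - B) \<union> (B - A) = {a, b} \<and> (a, b) \<in> parcs G)} \<rparr>)"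

lemma pair_graph_token_graph:
  assumes "pair_graph G"
  shows "pair_graph (token_graph k G)"
proof -
  interpret pair_graph G by (fact assms)
  let ?F = "token_graph k G"
  have fin: "finite (pverts ?F)"
    by (rule finite_subset[of _ "Pow (pverts G)"]) (auto simp: token_graph_def Let_def pair_finite_verts)
  have sub: "parcs ?F \<subseteq> pverts ?F \<times> pverts ?F"
    unfolding token_graph_def Let_def pair_pre_digraph.simps by blast
  have swap: "(B, A) \<in> parcs ?F" if "(A, B) \<in> parcs ?F" for A B
  proof -
    from that obtain a b where V: "A \<in> pverts ?F" "B \<in> pverts ?F"
      and ab: "a \<in> A" "b \<in> B" "(A - B) \<union> (B - A) = {a, b}" "(a, b) \<in> parcs G"
      unfolding token_graph_def Let_def pair_pre_digraph.simps by blast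
    have "(B - A) \<union> (A - B) = {b, a}" using ab(3) by (simp only: Un_commute insert_commute)
    moreover have "(b, a) \<in> parcs G" using ab(4) arcs_symmetric by blast
    ultimately show ?thesis using V ab(1,2)
      unfolding token_graph_def Let_def pair_pre_digraph.simps by blast
  qed
  have irr: "A \<noteq> B" if "(A, B) \<in> parcs ?F" for A B
    using that unfolding token_graph_def Let_def pair_pre_digraph.simps by blast
  show ?thesis
  proof unfold_locales
    show "finite (pverts ?F)" by (fact fin)
    show "finite (parcs ?F)"
      by (rule finite_subset[OF sub finite_cartesian_product[OF fin fin]])
    show "symmetric (with_proj ?F)"
      unfolding symmetric_def with_proj_simps by (rule symI) (rule swap)
    fix e assume e: "e \<in> parcs ?F"
    show "fst e \<in> pverts ?F" using subsetD[OF sub e] by (simp only: mem_Times_iff)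
    show "snd e \<in> pverts ?F" using subsetD[OF sub e] by (simp only: mem_Times_iff)
    show "fst e \<noteq> snd e" using irr[of "fst e" "snd e"] e by (simp only: prod.collapse simp_thms)
  qed
qed

end

theory Submission
  imports Defs
begin

text \<open>
  Induction on $k$. Let $d = t - k + 1$ and let $U$ be a set of fewer than $kd$ vertices of the token
  graph. Call a vertex $v$ of $G$ good if fewer than $(k-1)d$ members of $U$ contain it. The
  $k$-subsets containing $v$ form a copy of the $(k-1)$-token graph of $G - v$, so by induction
  those that contain a given good vertex and avoid $U$ lie in one component.

  If a $k$-subset outside $U$ contains no good vertex, counting incidences with $U$ shows that all
  other vertices of $G$ are good; having at least $kd$ neighbours, it has one outside $U$, and that
  neighbour contains a good vertex. So if removing $U$ disconnects the token graph, the good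
  vertices split into nonempty parts $P$ and $Q$ such that $U$ contains every $k$-subset meeting
  both. For $k \<ge> 4$ this puts at least $\binom{n-2}{k-2} \<ge> (k-1)d$ members of $U$ on a good
  vertex; $k = 2$ and $k = 3$ need finer counts.
\<close>

section \<open>Token adjacency and connectivity inside a vertex set\<close>

definition ksubsets :: "'a set \<Rightarrow> nat \<Rightarrow> 'a set set" where
  "ksubsets V k = {A. A \<subseteq> V \<and> card A = k}"

text \<open>Membership in a family of \<open>k\<close>-subsets is left out, so that one relation
  serves every \<open>k\<close> and every vertex set met in the induction.\<close>

definition token_adj :: "'a rel \<Rightarrow> 'a set rel" where
  "token_adj E = {(A, B). \<exists>a\<in>A. \<exists>b\<in>B. (A - B) \<union> (B - A) = {a, b} \<and> (a, b) \<in> E}"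

text \<open>
  Keeping the edge relation fixed while the vertex set \<open>V\<close> varies turns vertex deletion into set
  difference; edges of \<open>E\<close> leaving \<open>V\<close> are ignored.
\<close>

definition tconn :: "nat \<Rightarrow> 'a rel \<Rightarrow> 'a set \<Rightarrow> bool" where
  "tconn t E V \<longleftrightarrow> t < card V \<and>
     (\<forall>X. X \<subseteq> V \<and> card X < t \<longrightarrow> (\<forall>x\<in>V - X. \<forall>y\<in>V - X. (x, y) \<in> rtrancl_on (V - X) E))"

lemma tconnD:
  assumes "tconn t E V" "X \<subseteq> V" "card X < t" "x \<in> V - X" "y \<in> V - X"
  shows "(x, y) \<in> rtrancl_on (V - X) E"
  using assms unfolding tconn_def by blast

text \<open>Used to carry walks from vertices to singletons, from \<open>F\<close> to
  \<open>insert v F\<close>, and along the identity when two relations agree.\<close>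

lemma rtrancl_on_map:
  assumes "(x, y) \<in> rtrancl_on F r"
    and "\<And>a. a \<in> F \<Longrightarrow> f a \<in> F'"
    and "\<And>a b. a \<in> F \<Longrightarrow> b \<in> F \<Longrightarrow> (a, b) \<in> r \<Longrightarrow> (f a, f b) \<in> s"
  shows "(f x, f y) \<in> rtrancl_on F' s"
  using assms(1)
proof (induction rule: rtrancl_on_induct)
  case base
  then show ?case using assms(2) by auto
next
  case (step y z)
  then show ?case using assms(2,3) by (meson rtrancl_on_into_rtrancl_on)
qed

lemma tconn_delete:
  assumes "tconn t E V" "t > 0" "v \<in> V" "finite V"
  shows "tconn (t - 1) E (V - {v})"
proof -
  have "(x, y) \<in> rtrancl_on (V - {v} - X) E"
    if X: "X \<subseteq> V - {v}" "card X < t - 1" "x \<in> V - {v} - X" "y \<in> V - {v} - X" for X x y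
  proof -
    have "finite X" using X assms(4) by (meson finite_Diff finite_subset)
    then have "card (insert v X) < t" using X(2) by (auto simp: card_insert_if)
    then have "(x, y) \<in> rtrancl_on (V - insert v X) E"
      using tconnD[OF assms(1), of "insert v X" x y] X assms(3) by blast
    moreover have "V - insert v X = V - {v} - X" by blast
    ultimately show ?thesis by simp
  qed
  moreover have "t - 1 < card (V - {v})"
    using assms unfolding tconn_def by (auto simp: card_Diff_singleton)
  ultimately show ?thesis unfolding tconn_def by blast
qed

text \<open>Otherwise the neighbourhood of \<open>v\<close> has fewer than \<open>t\<close> elements
  and removing it isolates \<open>v\<close>. Since \<open>V\<close> has more than \<open>t\<close>
  vertices, some \<open>w\<close> other than \<open>v\<close> survives the removal.\<close>

lemma tconn_degree:
  assumes "tconn t E V" "finite V" "v \<in> V" "irrefl E"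
  shows "t \<le> card {x \<in> V. (v, x) \<in> E}"
proof (rule ccontr)
  let ?X = "{x \<in> V. (v, x) \<in> E}"
  assume "\<not> t \<le> card ?X"
  then have lt: "card ?X < t" by simp
  have vX: "v \<in> V - ?X" using assms(3,4) by (auto simp: irrefl_def)
  have "\<exists>w. w \<in> V - ?X \<and> w \<noteq> v"
  proof (rule ccontr)
    assume "\<nexists>w. w \<in> V - ?X \<and> w \<noteq> v"
    then have "V \<subseteq> insert v ?X" by blast
    then have "card V \<le> card (insert v ?X)" using assms(2) by (intro card_mono) auto
    also have "\<dots> \<le> Suc (card ?X)" by (simp add: card_insert_le_m1 card_insert_if)
    finally show False using assms(1) lt unfolding tconn_def by linarith
  qed
  then obtain w where w: "w \<in> V - ?X" "w \<noteq> v" by blast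
  have "(v, w) \<in> rtrancl_on (V - ?X) E"
    using tconnD[OF assms(1) _ lt vX w(1)] by blast
  then show False
  proof (cases rule: converse_rtrancl_on_cases)
    case base
    then show False using w by simp
  next
    case (step c)
    then have "c \<in> V - ?X" using in_rtrancl_on_in_F by fastforce
    then show False using step by blast
  qed
qed

section \<open>Single token moves and the number of \<open>k\<close>-subsets\<close>

lemma sym_token_adj:
  assumes "sym E"
  shows "sym (token_adj E)"
proof (rule symI)
  fix A B assume "(A, B) \<in> token_adj E"
  then obtain a b where "a \<in> A" "b \<in> B" "(A - B) \<union> (B - A) = {a, b}" "(a, b) \<in> E"
    unfolding token_adj_def by blast
  moreover from this have "(B - A) \<union> (A - B) = {b, a}" by (simp add: Un_commute insert_commute)
  ultimately show "(B, A) \<in> token_adj E"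
    using assms unfolding token_adj_def by (blast dest: symD)
qed

lemma token_adj_insert:
  assumes "v \<notin> A" "v \<notin> B" "(A, B) \<in> token_adj E"
  shows "(insert v A, insert v B) \<in> token_adj E"
proof -
  have "(insert v A - insert v B) \<union> (insert v B - insert v A) = (A - B) \<union> (B - A)"
    using assms by blast
  then show ?thesis using assms(3) unfolding token_adj_def by auto
qed

lemma token_adj_move:
  assumes "a \<in> A" "x \<notin> A" "(a, x) \<in> E"
  shows "(A, insert x (A - {a})) \<in> token_adj E"
proof -
  have "(A - insert x (A - {a})) \<union> (insert x (A - {a}) - A) = {a, x}"
    using assms by blast
  then show ?thesis using assms unfolding token_adj_def by blast
qed

lemma ksubsets_move:
  assumes "finite V" "A \<in> ksubsets V k" "a \<in> A" "x \<in> V - A"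
  shows "insert x (A - {a}) \<in> ksubsets V k"
proof -
  have "finite A" using assms by (auto simp: ksubsets_def intro: finite_subset)
  then have "card (insert x (A - {a})) = card A"
    using assms by (simp add: card_gt_0_iff card_Diff_singleton) (metis Suc_pred card_gt_0_iff empty_iff)
  then show ?thesis using assms by (auto simp: ksubsets_def)
qed

lemma finite_ksubsets: "finite V \<Longrightarrow> finite (ksubsets V k)"
  unfolding ksubsets_def by simp

lemma card_ksubsets: "finite V \<Longrightarrow> card (ksubsets V k) = card V choose k"
  unfolding ksubsets_def by (rule n_subsets)

lemma binomial_Suc_ge: "m \<le> (k + m) choose Suc k"
proof (induction m)
  case (Suc m)
  have "1 \<le> (k + m) choose k" by (simp add: Suc_leI)
  then show ?case using Suc by simp
qed simp

text \<open>By Pascal's rule, the step from \<open>k\<close> to \<open>Suc k\<close> adds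
  \<open>(k + m) choose Suc k\<close>, which is at least \<open>m\<close>.\<close>

lemma binomial_gt: "k * m < (k + m) choose k"
proof (induction k)
  case (Suc k)
  then show ?case using binomial_Suc_ge[of m k] by simp
qed simp

text \<open>Supplies the size requirement in the connectivity of the token graph. Since
  \<open>t < card V\<close>, the factor \<open>t - k + 1\<close> is at most
  \<open>card V - k\<close>.\<close>

lemma card_ksubsets_gt:
  assumes "finite V" "t < card V" "1 \<le> k" "k \<le> t"
  shows "k * (t - k + 1) < card (ksubsets V k)"
proof -
  have "k * (t - k + 1) \<le> k * (card V - k)" using assms by (intro mult_le_mono2) simp
  also have "\<dots> < (k + (card V - k)) choose k" by (rule binomial_gt)
  finally show ?thesis using assms by (simp add: card_ksubsets)
qed

text \<open>Each of the \<open>k\<close> elements of \<open>A\<close> has at least \<open>t\<close>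
  neighbours, at most \<open>k - 1\<close> of them in \<open>A\<close>. Distinct moves give distinct
  sets, because \<open>x\<close> is the only new element and \<open>a\<close> the only missing one.
  This is the minimum degree bound for the token graph.\<close>

lemma card_move_ge:
  assumes "tconn t E V" "finite V" "irrefl E" "A \<in> ksubsets V k" "1 \<le> k" "k \<le> t"
  defines "M \<equiv> {(a, x). a \<in> A \<and> x \<in> V - A \<and> (a, x) \<in> E}"
  shows "k * (t - k + 1) \<le> card ((\<lambda>(a, x). insert x (A - {a})) ` M)"
proof -
  have A: "A \<subseteq> V" "card A = k" "finite A"
    using assms(2,4) by (auto simp: ksubsets_def intro: finite_subset)
  have "inj_on (\<lambda>(a, x). insert x (A - {a})) M"
  proof (rule inj_onI, clarify)
    fix a x b y
    assume *: "(a, x) \<in> M" "(b, y) \<in> M" "insert x (A - {a}) = insert y (A - {b})"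
    then have m: "a \<in> A" "b \<in> A" "x \<notin> A" "y \<notin> A" by (auto simp: M_def)
    have "x = y" using *(3) m by blast
    moreover have "a = b"
    proof (rule ccontr)
      assume "a \<noteq> b"
      then have "a \<in> insert y (A - {b})" using m by blast
      then have "a \<in> insert x (A - {a})" by (simp only: *(3))
      then show False using m by blast
    qed
    ultimately show "a = b \<and> x = y" by simp
  qed
  then have "card ((\<lambda>(a, x). insert x (A - {a})) ` M) = card M" by (rule card_image)
  also have "card M = card (SIGMA a:A. {x \<in> V - A. (a, x) \<in> E})"
    by (rule arg_cong[of _ _ card]) (auto simp: M_def)
  also have "\<dots> = (\<Sum>a\<in>A. card {x \<in> V - A. (a, x) \<in> E})"
    using A assms(2) by simp
  also have "\<dots> \<ge> (\<Sum>a\<in>A. t - k + 1)"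
  proof (rule sum_mono)
    fix a assume a: "a \<in> A"
    have "{x \<in> V. (a, x) \<in> E} \<subseteq> {x \<in> V - A. (a, x) \<in> E} \<union> (A - {a})"
      using assms(3) by (auto simp: irrefl_def)
    then have "card {x \<in> V. (a, x) \<in> E} \<le> card ({x \<in> V - A. (a, x) \<in> E} \<union> (A - {a}))"
      using A assms(2) by (intro card_mono) auto
    also have "\<dots> \<le> card {x \<in> V - A. (a, x) \<in> E} + card (A - {a})" by (rule card_Un_le)
    finally have "t \<le> card {x \<in> V - A. (a, x) \<in> E} + (k - 1)"
      using tconn_degree[OF assms(1,2) _ assms(3), of a] a A by (auto simp: card_Diff_singleton)
    then show "t - k + 1 \<le> card {x \<in> V - A. (a, x) \<in> E}" using assms(5,6) by linarith
  qed
  finally show ?thesis using A(2) by (simp only: sum_constant of_nat_id)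
qed

section \<open>Vertices lying in few members of a cut\<close>

text \<open>\<open>U\<close> is the candidate cut, and \<open>d\<close> stands for
  \<open>t - k + 1\<close>, which stays fixed when \<open>k\<close> and \<open>t\<close> both drop
  by one.\<close>

locale token_cut =
  fixes V :: "'a set" and U :: "'a set set" and k d :: nat
  assumes finV: "finite V"
    and U_sub: "U \<subseteq> ksubsets V k"
    and card_U: "card U < k * d"
    and k2: "2 \<le> k"
begin

definition star :: "'a \<Rightarrow> 'a set set" where
  "star v = {A \<in> U. v \<in> A}"

definition good :: "'a set" where
  "good = {v \<in> V. card (star v) < (k - 1) * d}"

lemma d_pos: "0 < d" using card_U by (cases d) auto

lemma finU: "finite U"
  using finV U_sub finite_ksubsets finite_subset by metis

lemma fin_star: "finite (star v)" and star_sub: "star v \<subseteq> U"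
  using finU by (auto simp: star_def)

lemma card_mem_U: "A \<in> U \<Longrightarrow> card A = k" and mem_U_sub: "A \<in> U \<Longrightarrow> A \<subseteq> V"
  and fin_mem_U: "A \<in> U \<Longrightarrow> finite A"
  using U_sub finV by (auto simp: ksubsets_def intro: finite_subset)

lemma bad_star: "v \<in> V \<Longrightarrow> v \<notin> good \<Longrightarrow> (k - 1) * d \<le> card (star v)"
  by (auto simp: good_def)

text \<open>Double counting of the pairs \<open>v\<close>, \<open>C\<close> with \<open>v\<close> in
  \<open>C\<close>, \<open>v\<close> in \<open>Z\<close> and \<open>C\<close> in
  \<open>U\<close>.\<close>

lemma sum_card_star:
  assumes "finite Z"
  shows "(\<Sum>v\<in>Z. card (star v)) = (\<Sum>C\<in>U. card (C \<inter> Z))"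
proof -
  have "(\<Sum>v\<in>Z. card (star v)) = (\<Sum>v\<in>Z. \<Sum>C\<in>U. if v \<in> C then 1 else 0)"
    unfolding star_def card_eq_sum by (intro sum.cong refl sum.inter_filter finU)
  also have "\<dots> = (\<Sum>C\<in>U. \<Sum>v\<in>Z. if v \<in> C then 1 else 0)" by (rule sum.swap)
  also have "\<dots> = (\<Sum>C\<in>U. card (C \<inter> Z))"
  proof (rule sum.cong)
    fix C
    have "(\<Sum>v\<in>Z. if v \<in> C then 1 else (0::nat)) = card {v \<in> Z. v \<in> C}"
      unfolding card_eq_sum by (rule sum.inter_filter[OF assms, symmetric])
    moreover have "{v \<in> Z. v \<in> C} = C \<inter> Z" by blast
    ultimately show "(\<Sum>v\<in>Z. if v \<in> C then 1 else (0::nat)) = card (C \<inter> Z)" by simp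
  qed simp
  finally show ?thesis .
qed

text \<open>Otherwise \<open>insert z A\<close> consists of \<open>k + 1\<close> bad vertices and
  has at least \<open>(k + 1) * ((k - 1) * d)\<close> incidences with \<open>U\<close>. A member of
  \<open>U\<close> contributes at most \<open>k - 1\<close> of them, or \<open>k\<close> if it is a
  subset of \<open>insert z A\<close>. As \<open>A\<close> is not in \<open>U\<close>, there are at
  most \<open>k\<close> such subsets, which is too few.\<close>

lemma outside_bad_set_good:
  assumes A: "A \<in> ksubsets V k - U" "A \<inter> good = {}" and z: "z \<in> V - A"
  shows "z \<in> good"
proof (rule ccontr)
  assume bad: "z \<notin> good"
  define Z where "Z = insert z A"
  define W where "W = {C \<in> U. C \<subseteq> Z}"
  have fA: "finite A" "card A = k" "A \<subseteq> V"
    using A finV by (auto simp: ksubsets_def intro: finite_subset)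
  have Z: "finite Z" "card Z = k + 1" using fA z by (auto simp: Z_def)
  have "(k + 1) * ((k - 1) * d) = (\<Sum>v\<in>Z. (k - 1) * d)" using Z by simp
  also have "\<dots> \<le> (\<Sum>v\<in>Z. card (star v))"
    by (intro sum_mono bad_star) (use bad A z fA in \<open>auto simp: Z_def\<close>)
  also have "\<dots> = (\<Sum>C\<in>U. card (C \<inter> Z))" by (rule sum_card_star[OF Z(1)])
  also have "\<dots> \<le> (\<Sum>C\<in>U. (k - 1) + (if C \<subseteq> Z then 1 else 0))"
  proof (rule sum_mono)
    fix C assume C: "C \<in> U"
    show "card (C \<inter> Z) \<le> (k - 1) + (if C \<subseteq> Z then 1 else 0)"
    proof (cases "C \<subseteq> Z")
      case True
      then show ?thesis using card_mem_U[OF C] by (simp add: Int_absorb2)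
    next
      case False
      then have "C \<inter> Z \<subset> C" by blast
      then have "card (C \<inter> Z) < k" using psubset_card_mono fin_mem_U card_mem_U C by metis
      then show ?thesis using False by simp
    qed
  qed
  also have "\<dots> = card U * (k - 1) + card W"
  proof -
    have "(\<Sum>C\<in>U. if C \<subseteq> Z then 1 else (0::nat)) = card W"
      unfolding W_def card_eq_sum by (rule sum.inter_filter[OF finU, symmetric])
    then show ?thesis by (simp only: sum.distrib sum_constant of_nat_id)
  qed
  finally have main: "(k + 1) * ((k - 1) * d) \<le> card U * (k - 1) + card W" .
  have W1: "card W \<le> card U" using finU by (intro card_mono) (auto simp: W_def)
  have "W \<subseteq> ksubsets Z k - {A}" using A card_mem_U by (auto simp: W_def ksubsets_def)
  then have "card W \<le> card (ksubsets Z k - {A})"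
    using Z finite_ksubsets by (intro card_mono) auto
  also have "\<dots> = k"
  proof -
    have "A \<in> ksubsets Z k" using fA by (auto simp: ksubsets_def Z_def)
    then show ?thesis using Z by (simp add: card_ksubsets card_Diff_singleton)
  qed
  finally have W2: "card W \<le> k" .
  obtain j where j: "k = j + 2" using k2 by (metis le_add_diff_inverse2)
  have "card U * (j + 1) + (j + 1) \<le> (j + 2) * d * (j + 1)"
    using mult_le_mono1[of "card U + 1" "k * d" "j + 1"] card_U j by (simp add: algebra_simps)
  \<comment> \<open>With at most \<open>k * d - 1\<close> members of \<open>U\<close>, the excess of
    incidences that \<open>W\<close> must cover is \<open>(k - 1) * d + (k - 1)\<close>, while
    \<open>W\<close> has at most \<open>k\<close> members. This leaves only \<open>k = 2\<close> and
    \<open>d = 1\<close>, where \<open>U\<close> has at most one member but \<open>W\<close> needs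
    two.\<close>
  then have *: "(j + 1) * d + (j + 1) \<le> card W"
    using main j by (simp add: algebra_simps)
  have "(j + 1) * 1 \<le> (j + 1) * d" using d_pos by (intro mult_le_mono2) simp
  then have "2 * (j + 1) \<le> j + 2" using * W2 j by simp
  then have j0: "j = 0" by simp
  then have "d + 1 \<le> card W" "card W \<le> 2" using * W2 j by auto
  then have "d = 1" using d_pos by simp
  then show False using j0 j card_U W1 \<open>d + 1 \<le> card W\<close> by simp
qed

text \<open>The other \<open>k - 2\<close> elements of a \<open>k\<close>-subset through
  \<open>v\<close> and \<open>w\<close> can be chosen freely.\<close>

lemma card_star_inter:
  assumes "v \<in> V" "w \<in> V" "v \<noteq> w"
    and "\<And>C. C \<in> ksubsets V k \<Longrightarrow> v \<in> C \<Longrightarrow> w \<in> C \<Longrightarrow> C \<in> U"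
  shows "(card V - 2) choose (k - 2) \<le> card (star v \<inter> star w)"
proof -
  let ?S = "ksubsets (V - {v, w}) (k - 2)"
  have "card ?S = (card V - 2) choose (k - 2)"
    using finV assms by (simp add: card_ksubsets card_Diff_subset numeral_2_eq_2)
  moreover have "inj_on (\<lambda>C. insert v (insert w C)) ?S"
  proof (rule inj_onI)
    fix C D assume *: "C \<in> ?S" "D \<in> ?S" "insert v (insert w C) = insert v (insert w D)"
    then have "C = insert v (insert w C) - {v, w}" "D = insert v (insert w D) - {v, w}"
      by (auto simp: ksubsets_def)
    then show "C = D" using *(3) by simp
  qed
  moreover have "(\<lambda>C. insert v (insert w C)) ` ?S \<subseteq> star v \<inter> star w"
  proof (rule image_subsetI)
    fix C assume C: "C \<in> ?S"
    then have "finite C" "v \<notin> C" "w \<notin> C"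
      using finV by (auto simp: ksubsets_def intro: finite_subset)
    then have "insert v (insert w C) \<in> ksubsets V k"
      using C assms k2 by (auto simp: ksubsets_def)
    then show "insert v (insert w C) \<in> star v \<inter> star w"
      using assms(4) by (auto simp: star_def)
  qed
  ultimately show ?thesis
    using card_inj_on_le[of "\<lambda>C. insert v (insert w C)" ?S "star v \<inter> star w"] fin_star by simp
qed

end

section \<open>Excluding a separation of the good vertices\<close>

text \<open>The assumptions turn out to be contradictory. With \<open>t = d + k - 1\<close>, the two
  parts of \<open>order\<close> say \<open>t < card V\<close> and
  \<open>k * t <= 2 * card V\<close>.\<close>

locale token_separation = token_cut +
  fixes P Q :: "'a set"
  assumes good_split: "P \<union> Q = good" "P \<inter> Q = {}"
    and P_ne: "P \<noteq> {}" and Q_ne: "Q \<noteq> {}"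
    and crossing: "\<And>C. C \<in> ksubsets V k \<Longrightarrow> C \<inter> P \<noteq> {} \<Longrightarrow> C \<inter> Q \<noteq> {} \<Longrightarrow> C \<in> U"
    and order: "d + k \<le> card V" "k * (d + k - 1) \<le> 2 * card V"
begin

lemma swapped: "token_separation V U k d Q P"
  using good_split P_ne Q_ne crossing order
  by unfold_locales (auto simp: Un_commute Int_commute)

lemma subsets: "P \<subseteq> V" "Q \<subseteq> V" "finite P" "finite Q"
  using good_split finV by (auto simp: good_def intro: finite_subset)

lemma common_star:
  assumes "v \<in> P" "w \<in> Q"
  shows "(card V - 2) choose (k - 2) \<le> card (star v \<inter> star w)"
proof (rule card_star_inter)
  show "v \<in> V" "w \<in> V" "v \<noteq> w" using assms subsets good_split by auto
qed (use assms crossing in blast)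

lemma good_star:
  assumes "v \<in> P \<union> Q"
  shows "card (star v) < (k - 1) * d"
  using assms good_split by (auto simp: good_def)

text \<open>Put \<open>t = d + k - 1\<close>. Now \<open>card V\<close> is at least
  \<open>2 * t\<close>, so \<open>N = card V - 2\<close> is at least \<open>2 * (t - 1)\<close> and
  \<open>k - 2\<close> lies between 2 and \<open>N / 2\<close>. Hence
  \<open>N choose (k - 2)\<close> is at least \<open>N choose 2\<close>, which is at least
  \<open>(t - 1) * (2 * t - 3)\<close> and so at least \<open>(k - 1) * d\<close>.\<close>

lemma False_if_ge_4:
  assumes "4 \<le> k"
  shows False
proof -
  obtain v w where vw: "v \<in> P" "w \<in> Q" using P_ne Q_ne by blast
  have "4 * (d + k - 1) \<le> k * (d + k - 1)" using assms by simp
  then have n: "2 * (d + k - 1) \<le> card V" using order(2) by linarith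
  define N where "N = card V - 2"
  have N: "2 * (d + k - 2) \<le> N" using n d_pos assms by (simp add: N_def)
  have "(d + k - 2) * (2 * (d + k - 2) - 1) \<le> N choose 2"
  proof -
    have "(2 * (d + k - 2)) * (2 * (d + k - 2) - 1) \<le> N * (N - 1)"
      using N by (intro mult_le_mono) auto
    then have "(2 * (d + k - 2)) * (2 * (d + k - 2) - 1) div 2 \<le> N choose 2"
      by (simp only: choose_two div_le_mono)
    then show ?thesis by (simp add: mult.assoc)
  qed
  moreover have "N choose 2 \<le> N choose (k - 2)"
    using N assms d_pos by (intro binomial_mono) auto
  moreover have "(k - 1) * d \<le> (d + k - 2) * (2 * (d + k - 2) - 1)"
    using d_pos assms by (intro mult_le_mono) auto
  moreover have "N choose (k - 2) \<le> card (star v)"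
    using common_star[OF vw] card_mono[OF fin_star, of "star v \<inter> star w" v] by (simp add: N_def)
  moreover have "card (star v) < (k - 1) * d" using good_star vw by blast
  ultimately show False by linarith
qed

text \<open>For \<open>v\<close> in \<open>P\<close> and two elements \<open>w\<close>,
  \<open>w'\<close> of \<open>Q\<close>, all triples through \<open>v\<close> and \<open>w\<close>
  or through \<open>v\<close> and \<open>w'\<close> lie in \<open>U\<close>. The two families share
  only one triple, so \<open>star v\<close> has at least \<open>2 * (card V - 2) - 1\<close>
  members. This exceeds \<open>2 * d\<close>, although \<open>v\<close> is good.\<close>

lemma card_Q_le_1:
  assumes "k = 3"
  shows "card Q \<le> 1"
proof (rule ccontr)
  assume "\<not> card Q \<le> 1"
  then obtain w w' where w: "w \<in> Q" "w' \<in> Q" "w \<noteq> w'"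
    by (metis card_le_Suc0_iff_eq subsets(4) One_nat_def)
  obtain v where v: "v \<in> P" using P_ne by blast
  have vw: "v \<noteq> w" "v \<noteq> w'" using v w good_split by auto
  let ?A = "star v \<inter> star w" and ?B = "star v \<inter> star w'"
  have "?A \<inter> ?B \<subseteq> {{v, w, w'}}"
  proof
    fix C assume C: "C \<in> ?A \<inter> ?B"
    then have sub: "{v, w, w'} \<subseteq> C" "C \<in> U" by (auto simp: star_def)
    have "{v, w, w'} = C"
      using vw w(3) assms card_mem_U[OF sub(2)] by (intro card_subset_eq fin_mem_U sub) auto
    then show "C \<in> {{v, w, w'}}" by simp
  qed
  then have "card (?A \<inter> ?B) \<le> card {{v, w, w'}}" by (intro card_mono) auto
  moreover have "card ?A + card ?B = card (?A \<union> ?B) + card (?A \<inter> ?B)"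
    using fin_star by (intro card_Un_Int) auto
  moreover have "card (?A \<union> ?B) \<le> card (star v)" by (intro card_mono fin_star) auto
  moreover have "card V - 2 \<le> card ?A" "card V - 2 \<le> card ?B"
    using common_star[OF v w(1)] common_star[OF v w(2)] assms by auto
  moreover have "card (star v) < 2 * d" using good_star[of v] v assms by simp
  ultimately show False using order(1) assms by simp
qed

text \<open>Only two good vertices remain, so at least \<open>n - 2\<close> vertices lie in at least
  \<open>2 * d\<close> members of \<open>U\<close> each, against fewer than \<open>9 * d\<close>
  incidences in total. This bounds \<open>n\<close>, and the few remaining values fail by
  \<open>order\<close>.\<close>

lemma False_if_eq_3:
  assumes k: "k = 3"
  shows False
proof -
  have "card Q \<le> 1" by (rule card_Q_le_1[OF k])
  moreover have "card P \<le> 1" by (rule token_separation.card_Q_le_1[OF swapped k])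
  moreover have "card good \<le> card P + card Q" using good_split card_Un_le by metis
  ultimately have g: "card good \<le> 2" by linarith
  obtain v w where vw: "v \<in> P" "w \<in> Q" using P_ne Q_ne by blast
  define n where "n = card V"
  have "n - 2 \<le> card (star v)"
    using common_star[OF vw] card_mono[OF fin_star, of "star v \<inter> star w" v] k by (simp add: n_def)
  then have n1: "n - 2 < 2 * d" using good_star[of v] vw k by simp
  have "good \<subseteq> V" by (auto simp: good_def)
  then have "n - 2 \<le> card (V - good)"
    using g finV by (simp add: card_Diff_subset finite_subset n_def)
  then have "(n - 2) * (2 * d) \<le> card (V - good) * (2 * d)" by simp
  also have "\<dots> = (\<Sum>x\<in>V - good. (k - 1) * d)" by (simp add: k)
  also have "\<dots> \<le> (\<Sum>x\<in>V - good. card (star x))"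
    by (intro sum_mono bad_star) auto
  also have "\<dots> = (\<Sum>C\<in>U. card (C \<inter> (V - good)))" using finV by (intro sum_card_star) auto
  also have "\<dots> \<le> (\<Sum>C\<in>U. k)"
    by (intro sum_mono) (metis Int_lower1 card_mono card_mem_U fin_mem_U)
  also have "\<dots> < 9 * d" using card_U k by simp
  finally have "n - 2 < 5" using d_pos by (cases "n - 2 < 5") (auto simp: not_less dest: mult_le_mono1[of 5 _ "2 * d"])
  moreover have "d + 3 \<le> n" "3 * (d + 2) \<le> 2 * n" using order k by (auto simp: n_def)
  moreover from calculation have "d = 1 \<or> d = 2" using d_pos by auto
  \<comment> \<open>For \<open>d = 1\<close> the order bound gives \<open>n >= 5\<close>, for
    \<open>d = 2\<close> it gives \<open>n >= 6\<close>; both contradict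
    \<open>n - 2 < 2 * d\<close>.\<close>
  ultimately show False using n1 by auto
qed

text \<open>
  Here $U$ is the edge set of a graph on $V$ with fewer than $2d$ edges. Two bad vertices together
  with a $P$-$Q$ edge already give $2d$ edges, as does one bad vertex together with all
  $P$-$Q$ edges. If all vertices are good, then $|P|, |Q| < d$ and $|P| + |Q| \<ge> d + 2$, so
  $|P|, |Q| \<ge> 3$ and $|P||Q| \<ge> 2(|P| + |Q| - 2) \<ge> 2d$.
\<close>

lemma False_if_eq_2:
  assumes k: "k = 2"
  shows False
proof -
  have bad_ge: "d \<le> card (star x)" if "x \<in> V - good" for x using bad_star[of x] that k by simp
  have cross: "{p, q} \<in> U" if "p \<in> P" "q \<in> Q" for p q
  proof (rule crossing)
    have "p \<noteq> q" using that good_split by auto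
    then show "{p, q} \<in> ksubsets V k" using that subsets k by (auto simp: ksubsets_def)
  qed (use that in auto)
  let ?K = "(\<lambda>(p, q). {p, q}) ` (P \<times> Q)"
  have "inj_on (\<lambda>(p, q). {p, q}) (P \<times> Q)"
    using good_split by (auto intro!: inj_onI simp: doubleton_eq_iff)
  then have K: "card ?K = card P * card Q" by (simp add: card_image card_cartesian_product)
  have KU: "?K \<subseteq> U" using cross by auto
  have K_star: "?K \<inter> star x = {}" if "x \<in> V - good" for x
    using that good_split by (auto simp: star_def)
  have sizes: "card P + card Q + card (V - good) = card V"
  proof -
    have "card good = card P + card Q"
      using good_split subsets card_Un_disjoint by metis
    moreover have "good \<subseteq> V" by (auto simp: good_def)
    then have "card good + card (V - good) = card V"
      using finV by (simp add: card_Diff_subset card_mono finite_subset)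
    ultimately show ?thesis by simp
  qed
  have pos: "1 \<le> card P" "1 \<le> card Q"
    using P_ne Q_ne subsets by (auto simp: Suc_le_eq card_gt_0_iff)
  consider "card (V - good) = 0" | "card (V - good) = 1" | "2 \<le> card (V - good)" by linarith
  then show False
  proof cases
    case 1
    \<comment> \<open>Stated for arbitrary parts so that it applies to \<open>P\<close> and
      \<open>Q\<close> in either order. The pairs joining one \<open>v\<close> in \<open>P\<close>
      to all of \<open>Q\<close> lie in \<open>star v\<close>.\<close>
    have *: "card Q < d" if "token_separation V U k d P Q" for P Q
    proof -
      interpret S: token_separation V U k d P Q by (fact that)
      obtain v where v: "v \<in> P" using S.P_ne by blast
      have "{v, q} \<in> star v" if "q \<in> Q" for q
      proof -
        have "v \<noteq> q" using that v S.good_split by auto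
        then have "{v, q} \<in> ksubsets V k"
          using that v S.subsets k by (auto simp: ksubsets_def)
        then show ?thesis using S.crossing that v by (auto simp: star_def)
      qed
      moreover have "inj_on (\<lambda>q. {v, q}) Q" by (auto intro!: inj_onI simp: doubleton_eq_iff)
      ultimately have "card Q \<le> card (star v)"
        by (intro card_inj_on_le[of "\<lambda>q. {v, q}"] fin_star) auto
      then show ?thesis using S.good_star[of v] v k by simp
    qed
    have "card Q < d" "card P < d"
      using *[of P Q] *[of Q P] swapped token_separation_axioms by auto
    moreover have "d + 2 \<le> card P + card Q" using sizes 1 order k by simp
    ultimately have "2 \<le> card P" "2 \<le> card Q" and d: "d + 2 \<le> card P + card Q" by linarith+
    then obtain p q where pq: "card P = p + 2" "card Q = q + 2"
      by (metis le_add_diff_inverse2)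
    have "2 * d \<le> card P * card Q" using pq d by (simp add: algebra_simps)
    also have "\<dots> \<le> card U" using K card_mono[OF finU KU] by simp
    finally show False using card_U k by simp
  next
    case 2
    then obtain x where x: "x \<in> V - good" by (metis card.empty ex_in_conv zero_neq_one)
    obtain p q where pq: "card P = p + 1" "card Q = q + 1"
      using pos by (metis le_add_diff_inverse2)
    have "d + 1 \<le> card P + card Q" using sizes 2 order k by simp
    \<comment> \<open>The product \<open>(p + 1) * (q + 1)\<close> is at least
      \<open>p + q + 1\<close>.\<close>
    then have "d \<le> card P * card Q" using pq by (simp add: algebra_simps)
    moreover have "card (?K \<union> star x) = card ?K + card (star x)"
      using K_star[OF x] fin_star subsets by (intro card_Un_disjoint) auto
    moreover have "card (?K \<union> star x) \<le> card U"
      using KU star_sub by (intro card_mono finU) auto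
    ultimately show False using K bad_ge[OF x] card_U k by simp
  next
    case 3
    then obtain x y where xy: "x \<in> V - good" "y \<in> V - good" "x \<noteq> y"
      using finV card_le_Suc0_iff_eq[of "V - good"] by fastforce
    obtain v w where vw: "v \<in> P" "w \<in> Q" using P_ne Q_ne by blast
    \<comment> \<open>Only the edge \<open>{x, y}\<close> can be counted twice; the edge
      \<open>{v, w}\<close> makes up for it.\<close>
    have "star x \<inter> star y \<subseteq> {{x, y}}"
    proof
      fix C assume C: "C \<in> star x \<inter> star y"
      then have sub: "{x, y} \<subseteq> C" "C \<in> U" by (auto simp: star_def)
      have "{x, y} = C"
        using xy k card_mem_U[OF sub(2)] by (intro card_subset_eq fin_mem_U sub) auto
      then show "C \<in> {{x, y}}" by simp
    qed
    then have "card (star x \<inter> star y) \<le> card {{x, y}}" by (intro card_mono) auto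
    moreover have "card (star x) + card (star y) = card (star x \<union> star y) + card (star x \<inter> star y)"
      by (intro card_Un_Int fin_star)
    moreover have "card (insert {v, w} (star x \<union> star y)) = card (star x \<union> star y) + 1"
    proof -
      have "{v, w} \<notin> star x \<union> star y" using xy vw good_split by (auto simp: star_def)
      then show ?thesis using fin_star by simp
    qed
    moreover have "card (insert {v, w} (star x \<union> star y)) \<le> card U"
      using star_sub cross[OF vw] by (intro card_mono finU) auto
    ultimately show False using bad_ge[OF xy(1)] bad_ge[OF xy(2)] card_U k by simp
  qed
qed

lemma contradiction: False
  using False_if_eq_2 False_if_eq_3 False_if_ge_4 k2 by (cases "k = 2"; cases "k = 3"; simp)

end

section \<open>Induction on the number of tokens\<close>

lemma token_connected:
  assumes "finite V" "sym E" "irrefl E"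
    and "tconn t E V" "1 \<le> k" "k \<le> t" "k * t \<le> 2 * card V"
    and "U \<subseteq> ksubsets V k" "card U < k * (t - k + 1)"
    and "A \<in> ksubsets V k - U" "B \<in> ksubsets V k - U"
  shows "(A, B) \<in> rtrancl_on (ksubsets V k - U) (token_adj E)"
  using assms(5,1,4,6-)
proof (induction k arbitrary: V t U A B rule: nat_induct_at_least)
  case base
  obtain a b where ab: "A = {a}" "B = {b}"
    using base by (auto simp: ksubsets_def card_1_singleton_iff)
  \<comment> \<open>For one token, a cut of the token graph is a cut of the graph itself.\<close>
  define X where "X = {x \<in> V. {x} \<in> U}"
  have "card X = card ((\<lambda>x. {x}) ` X)" by (simp add: card_image)
  also have "\<dots> \<le> card U"
    using base finite_subset[OF _ finite_ksubsets, of U V 1] by (intro card_mono) (auto simp: X_def)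
  finally have "card X < t" using base by simp
  then have "(a, b) \<in> rtrancl_on (V - X) E"
    using base ab by (intro tconnD[of t]) (auto simp: X_def ksubsets_def)
  then have "({a}, {b}) \<in> rtrancl_on (ksubsets V 1 - U) (token_adj E)"
  proof (rule rtrancl_on_map)
    fix x y assume xy: "x \<in> V - X" "y \<in> V - X" "(x, y) \<in> E"
    then have "x \<noteq> y" using assms(3) by (auto simp: irrefl_def)
    then have "({x} - {y}) \<union> ({y} - {x}) = {x, y}" by auto
    then show "({x}, {y}) \<in> token_adj E" using xy unfolding token_adj_def by blast
  qed (auto simp: X_def ksubsets_def)
  then show ?case using ab by simp
next
  case (Suc k)
  define d where "d = t - k"
  have d: "t - Suc k + 1 = d" "t - 1 - k + 1 = d" "t = d + Suc k - 1" "0 < d"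
    using Suc.prems Suc.hyps by (auto simp: d_def)
  let ?W = "ksubsets V (Suc k) - U"
  let ?R = "rtrancl_on ?W (token_adj E)"
  interpret token_cut V U "Suc k" d
    using Suc.prems Suc.hyps d by unfold_locales auto
  have symR: "(D, C) \<in> ?R" if "(C, D) \<in> ?R" for C D
    using rtrancl_on_sym[OF sym_token_adj[OF assms(2)]] that by (meson symD)
  have link: "(C, D) \<in> ?R" if v: "v \<in> good" "v \<in> C" "v \<in> D" and CD: "C \<in> ?W" "D \<in> ?W" for v C D
  proof -
    have vV: "v \<in> V" using v by (auto simp: good_def)
    \<comment> \<open>The trace of the cut on the copy of the \<open>k\<close>-token graph at
      \<open>v\<close>. It has fewer than \<open>k * d\<close> members because \<open>v\<close> is
      good.\<close>
    let ?X = "(\<lambda>C. C - {v}) ` star v"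
    have del: "F - {v} \<in> ksubsets (V - {v}) k - ?X" if F: "F \<in> ?W" "v \<in> F" for F
    proof -
      have "F - {v} \<noteq> F' - {v}" if "F' \<in> star v" for F'
      proof
        assume "F - {v} = F' - {v}"
        then have "F = F'" using that F by (auto simp: star_def)
        then show False using that F by (auto simp: star_def)
      qed
      then show ?thesis using F finV by (auto simp: ksubsets_def card_Diff_singleton)
    qed
    have "(C - {v}, D - {v}) \<in> rtrancl_on (ksubsets (V - {v}) k - ?X) (token_adj E)"
    proof (rule Suc.IH)
      show "finite (V - {v})" using finV by simp
      show "tconn (t - 1) E (V - {v})" using Suc.prems vV by (intro tconn_delete) auto
      show "k \<le> t - 1" using Suc.prems by simp
      \<comment> \<open>Deleting \<open>v\<close> lowers \<open>2 * card V\<close> by 2, which is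
        absorbed because \<open>t\<close> is at least \<open>Suc k\<close> and hence at least
        2.\<close>
      have "2 + k * (t - 1) \<le> t + k * t"
        using d Suc.hyps by (intro add_le_mono mult_le_mono2) simp_all
      then show "k * (t - 1) \<le> 2 * card (V - {v})"
        using Suc.prems vV by (simp add: card_Diff_singleton)
      show "?X \<subseteq> ksubsets (V - {v}) k"
      proof (rule image_subsetI)
        fix C assume "C \<in> star v"
        then show "C - {v} \<in> ksubsets (V - {v}) k"
          using mem_U_sub[of C] card_mem_U[of C] by (auto simp: star_def ksubsets_def card_Diff_singleton)
      qed
      have "card ?X \<le> card (star v)" by (intro card_image_le fin_star)
      then show "card ?X < k * (t - 1 - k + 1)" using v d by (simp add: good_def)
    qed (use del CD v in auto)
    then have "(insert v (C - {v}), insert v (D - {v})) \<in> ?R"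
    proof (rule rtrancl_on_map)
      fix F assume F: "F \<in> ksubsets (V - {v}) k - ?X"
      then have "finite F" "v \<notin> F" using finV by (auto simp: ksubsets_def intro: finite_subset)
      then have "insert v F \<in> ksubsets V (Suc k)" "F = insert v F - {v}"
        using F vV by (auto simp: ksubsets_def)
      moreover from this have "insert v F \<notin> U" using F by (auto simp: star_def)
      ultimately show "insert v F \<in> ?W" by blast
    next
      fix F F' assume "F \<in> ksubsets (V - {v}) k - ?X" "F' \<in> ksubsets (V - {v}) k - ?X"
        "(F, F') \<in> token_adj E"
      then show "(insert v F, insert v F') \<in> token_adj E"
        by (intro token_adj_insert) (auto simp: ksubsets_def)
    qed
    then show ?thesis using v by (simp add: insert_absorb)
  qed
  have to_good: "\<exists>D\<in>?W. (C, D) \<in> ?R \<and> D \<inter> good \<noteq> {}" if C: "C \<in> ?W" for C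
  proof (cases "C \<inter> good = {}")
    case False
    then show ?thesis using C by auto
  next
    case True
    let ?M = "{(a, x). a \<in> C \<and> x \<in> V - C \<and> (a, x) \<in> E}"
    let ?N = "(\<lambda>(a, x). insert x (C - {a})) ` ?M"
    have "Suc k * (t - Suc k + 1) \<le> card ?N"
      using Suc.prems C assms(3) by (intro card_move_ge) auto
    then have "\<not> ?N \<subseteq> U"
      using card_mono[OF finU, of ?N] Suc.prems(6) by linarith
    then obtain a x where ax: "a \<in> C" "x \<in> V - C" "(a, x) \<in> E" "insert x (C - {a}) \<notin> U"
      by auto
    let ?D = "insert x (C - {a})"
    have D: "?D \<in> ?W" using ksubsets_move[OF finV _ ax(1,2)] C ax by blast
    moreover have "(C, ?D) \<in> token_adj E" using ax by (intro token_adj_move) auto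
    then have "(C, ?D) \<in> ?R" using C D by (meson rtrancl_on_refl rtrancl_on_into_rtrancl_on)
    moreover have "x \<in> good" using outside_bad_set_good[OF C True ax(2)] .
    ultimately show ?thesis by blast
  qed
  obtain A' where A': "A' \<in> ?W" "(A, A') \<in> ?R" "A' \<inter> good \<noteq> {}" using to_good Suc.prems(7) by blast
  obtain B' where B': "B' \<in> ?W" "(B, B') \<in> ?R" "B' \<inter> good \<noteq> {}" using to_good Suc.prems(8) by blast
  obtain v w where vw: "v \<in> A'" "v \<in> good" "w \<in> B'" "w \<in> good" using A' B' by blast
  have "(A', B') \<in> ?R"
  proof (rule ccontr)
    assume no: "(A', B') \<notin> ?R"
    \<comment> \<open>The good vertices met by the component of \<open>A'\<close>. By
      \<open>link\<close>, that component contains every set outside \<open>U\<close> through a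
      vertex of \<open>P\<close>. Hence \<open>w\<close> is not in \<open>P\<close>, and a set
      outside \<open>U\<close> that meets \<open>P\<close> has all its good vertices in
      \<open>P\<close>.\<close>
    define P where "P = {x \<in> good. \<exists>C\<in>?W. x \<in> C \<and> (A', C) \<in> ?R}"
    have P_closed: "(A', C) \<in> ?R" if "x \<in> P" "x \<in> C" "C \<in> ?W" for x C
      using that link unfolding P_def by (blast intro: rtrancl_on_trans)
    interpret token_separation V U "Suc k" d P "good - P"
    proof unfold_locales
      show "P \<noteq> {}" using vw A' by (auto simp: P_def)
      show "good - P \<noteq> {}" using P_closed[of w B'] vw B' no by blast
      show "C \<in> U" if "C \<in> ksubsets V (Suc k)" "C \<inter> P \<noteq> {}" "C \<inter> (good - P) \<noteq> {}" for C
      proof (rule ccontr)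
        assume "C \<notin> U"
        then have "C \<in> ?W" using that by blast
        then have "(A', C) \<in> ?R" using P_closed that by blast
        then show False using that \<open>C \<in> ?W\<close> by (auto simp: P_def)
      qed
      show "d + Suc k \<le> card V" using Suc.prems d by (simp add: tconn_def)
      show "Suc k * (d + Suc k - 1) \<le> 2 * card V" using Suc.prems d by simp
    qed (auto simp: P_def)
    show False by (rule contradiction)
  qed
  then show ?case using A'(2) symR[OF B'(2)] by (blast intro: rtrancl_on_trans)
qed

section \<open>Transfer to connectivity of graphs\<close>

lemma rtrancl_on_cong:
  assumes "\<And>x y. x \<in> F \<Longrightarrow> y \<in> F \<Longrightarrow> (x, y) \<in> r \<longleftrightarrow> (x, y) \<in> s"
  shows "rtrancl_on F r = rtrancl_on F s"
proof -
  have "(id x, id y) \<in> rtrancl_on F s" if "(x, y) \<in> rtrancl_on F r" for x y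
    using that assms by (auto intro!: rtrancl_on_map[of _ _ F r])
  moreover have "(id x, id y) \<in> rtrancl_on F r" if "(x, y) \<in> rtrancl_on F s" for x y
    using that assms by (auto intro!: rtrancl_on_map[of _ _ F s])
  ultimately show ?thesis by auto
qed

text \<open>\<open>connected\<close> refers to the symmetric closure, which adds nothing inside
  \<open>W\<close> because \<open>parcs G\<close> is already symmetric.\<close>

lemma connected_restrict_iff:
  assumes "sym (parcs G)"
  shows "connected (with_proj G \<restriction> W) \<longleftrightarrow>
    W \<noteq> {} \<and> (\<forall>x\<in>W. \<forall>y\<in>W. (x, y) \<in> rtrancl_on W (parcs G))"
proof -
  let ?H = "with_proj (mk_symmetric (with_proj G \<restriction> W))"
  have "verts ?H = W" by (simp add: mk_symmetric_def)
  moreover have "(x, y) \<in> arcs_ends ?H \<longleftrightarrow> (x, y) \<in> parcs G" if "x \<in> W" "y \<in> W" for x y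
    using that assms by (force simp: mk_symmetric_def arcs_ends_def arc_to_ends_def sym_def)
  then have "rtrancl_on W (arcs_ends ?H) = rtrancl_on W (parcs G)" by (rule rtrancl_on_cong)
  ultimately show ?thesis
    unfolding connected_def strongly_connected_def reachable_def by simp
qed

text \<open>The nonemptiness demanded by \<open>connected\<close> follows from
  \<open>card X < t\<close> and \<open>t < card (pverts G)\<close>.\<close>

lemma t_connected_iff_tconn:
  assumes "pair_graph G"
  shows "t_connected t G \<longleftrightarrow> tconn t (parcs G) (pverts G)"
proof -
  interpret pair_graph G by (fact assms)
  have "sym (parcs G)" using sym_arcs by (simp add: symmetric_def)
  then have c: "connected (with_proj G \<restriction> W) \<longleftrightarrow>
      W \<noteq> {} \<and> (\<forall>x\<in>W. \<forall>y\<in>W. (x, y) \<in> rtrancl_on W (parcs G))" for W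
    by (rule connected_restrict_iff)
  have "pverts G - X \<noteq> {}" if "X \<subseteq> pverts G" "card X < t" "t < card (pverts G)" for X
    using that by auto
  then show ?thesis unfolding t_connected_def tconn_def c by blast
qed

lemma pverts_token_graph:
  assumes "finite (pverts G)"
  shows "pverts (token_graph k G) = ksubsets (pverts G) k"
  using assms by (auto simp: token_graph_def Let_def ksubsets_def intro: finite_subset)

lemma parcs_token_graph:
  assumes "A \<in> pverts (token_graph k G)" "B \<in> pverts (token_graph k G)"
  shows "(A, B) \<in> parcs (token_graph k G) \<longleftrightarrow> (A, B) \<in> token_adj (parcs G)"
  using assms by (simp add: token_graph_def Let_def token_adj_def)

theorem theorem6:
  fixes G :: "'a pair_pre_digraph" and k t n :: nat
  assumes "k \<ge> 1"
    and "pair_graph G"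
    and "t_connected t G"
    and "n = card (pverts G)"
    and "n \<ge> k + 1"
    and "t \<ge> k"
    and "real n \<ge> 1 / 2 * real k * real t"
  shows "t_connected (k * (t - k + 1)) (token_graph k G)"
proof -
  interpret pair_graph G by (fact assms(2))
  let ?V = "pverts G" and ?E = "parcs G"
  let ?F = "token_graph k G"
  have G: "finite ?V" "sym ?E" "irrefl ?E"
    using pair_finite_verts sym_arcs no_loops' by (auto simp: symmetric_def irrefl_def)
  have conn: "tconn t ?E ?V" using assms(3) t_connected_iff_tconn[OF assms(2)] by blast
  have "real (k * t) \<le> real (2 * n)" using assms(7) by simp
  then have order: "k * t \<le> 2 * card ?V" using assms(4) by linarith
  note verts = pverts_token_graph[OF G(1), of k]
  have "tconn (k * (t - k + 1)) (parcs ?F) (pverts ?F)"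
    unfolding tconn_def
  proof (intro conjI allI impI ballI; (elim conjE)?)
    show "k * (t - k + 1) < card (pverts ?F)"
      using conn assms(1,6) G(1) unfolding verts tconn_def by (intro card_ksubsets_gt) auto
  next
    fix U A B
    assume U: "U \<subseteq> pverts ?F" "card U < k * (t - k + 1)" "A \<in> pverts ?F - U" "B \<in> pverts ?F - U"
    then have "(A, B) \<in> rtrancl_on (pverts ?F - U) (token_adj ?E)"
      using token_connected[OF G conn assms(1,6) order, of U A B] verts by simp
    also have "rtrancl_on (pverts ?F - U) (token_adj ?E) = rtrancl_on (pverts ?F - U) (parcs ?F)"
      by (rule rtrancl_on_cong) (use parcs_token_graph[of _ k G] in blast)
    finally show "(A, B) \<in> rtrancl_on (pverts ?F - U) (parcs ?F)" .
  qed
  then show ?thesis using t_connected_iff_tconn[OF pair_graph_token_graph[OF assms(2)]] by blast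
qed

end
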